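(* Let $k\ge 1$ and assume $\operatorname{int}S_{k-1}\neq\emptyset$. Let $\mathbf{x}_k$ be a vertex of $S_k$. Then there exists $\mathbf{x}_{k-1}\in\partial S_{k-1}$ such that $\mathbf{x}_k\in X(\mathbf{x}_{k-1},z_k)$. Furthermore, for all $\mathbf{x}_{k-1}^{\ast}\in R(\mathbf{x}_{k-1})$, there holds $(\mathbf{x}_k,\mathbf{x}_k^{\ast})\in T(\mathbf{x}_{k-1},\mathbf{x}_{k-1}^{\ast},z_k)$ for some $\mathbf{x}_k^{\ast}\in C_{S_k}^{O}(\mathbf{x}_k)$.
   Context: Let $m\ge 1$ be an integer, and let $(d_1,\dots,d_{m+1})$, $(n_1,\dots,n_{m+1})$ be real vectors with $d_1=1$, $d_{m+1}\neq 0$, such that the polynomials $\sum_{i=1}^{m+1}n_i\lambda^{i-1}$ and $\sum_{i=1}^{m+1}d_i\lambda^{i-1}$ are coprime. Estimation system. $A$ is the $m\times m$ matrix with ones on the first superdiagonal, last row $(-d_{m+1},-d_m,\dots,-d_2)$ and zeros elsewhere; $B=(0,\dots,0,1)^T\in\mathbb{R}^m$; $C$ is the row vector $(n_{m+1},\dots,n_2)-n_1(d_{m+1},\dots,d_2)$; $D_1=n_1$. The dynamics are $\mathbf{x}_k=A\mathbf{x}_{k-1}+Bv_k$, $y_k=C\mathbf{x}_{k-1}+D_1v_k$, with given initial state $\mathbf{x}_0\in\mathbb{R}^m$ and given real measurements $z_1,z_2,\dots$. The uncertainty sets are the polytopes $S_0=\{\mathbf{x}_0\}$ and, for $k\ge1$,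 $$S_k=\{A\mathbf{x}+Bv:\ \mathbf{x}\in S_{k-1},\ |v|\le 1,\ |C\mathbf{x}+D_1v-z_k|\le 1\}.$$ Regulator matrices. $A^{\ast}$ is the $m\times m$ matrix with first column $-\frac{1}{d_{m+1}}(d_m,d_{m-1},\dots,d_1)^T$, ones on the first superdiagonal, zeros elsewhere (for $m=1$, $A^{\ast}=-1/d_2$); $B^{\ast}=(n_m,\dots,n_1)^T-\frac{n_{m+1}}{d_{m+1}}(d_m,\dots,d_1)^T$. For a polytope $S\subset\mathbb{R}^m$, $\partial S$ and $\operatorname{int}S$ are its boundary and interior, $h_S(\mathbf{x}^{\ast})=\max_{\mathbf{x}\in S}\langle\mathbf{x}^{\ast},\mathbf{x}\rangle$, and for $\mathbf{x}\in\partial S$, $C_S^{O}(\mathbf{x})=\{\mathbf{x}^{\ast}\neq\mathbf{0}:\langle\mathbf{x}^{\ast},\mathbf{x}\rangle=h_S(\mathbf{x}^{\ast})\}$. $(\mathbf{x}^{\ast})_1$ is the first component of $\mathbf{x}^{\ast}$. The scalar pair $(y,v)$ is aligned at time $k$ with $(y^{\ast},v^{\ast})$ if: $v^{\ast}>0\Rightarrow v=1$; $v^{\ast}<0\Rightarrow v=-1$; $|v|<1\Rightarrow v^{\ast}=0$; $y^{\ast}>0\Rightarrow y=1+z_k$; $y^{\ast}<0\Rightarrow y=-1+z_k$; $|y-z_k|<1\Rightarrow y^{\ast}=0$. For scalars $s,t,z_k$, $M(s,t,z_k)$ is the set of quadruples $\mathbf{q}=(q_1,q_2,q_3,q_4)=(v,y,v^{\ast},y^{\ast})\in\mathbb{R}^4$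 with: $|v|\le1$ and $|y-z_k|\le1$; $y-n_1v=s$; $d_{m+1}v^{\ast}+n_{m+1}y^{\ast}=-t$; and $(y,v)$ aligned at time $k$ with $(y^{\ast},v^{\ast})$. For $\mathbf{x}_{k-1}\in\partial S_{k-1}$ let $R_1,R_2,R_3$ be the subsets of $C_{S_{k-1}}^{O}(\mathbf{x}_{k-1})$ of vectors with first component respectively $=0$, $>0$, $<0$. Define $R(\mathbf{x}_{k-1})=R_1$ if $R_1\neq\emptyset$; $R(\mathbf{x}_{k-1})=R_2$ if $R_1=\emptyset$ and $R_2\neq\emptyset$; $R(\mathbf{x}_{k-1})=R_3$ if $R_1=\emptyset$ and $R_3\neq\emptyset$ (if $R_1=\emptyset$, exactly one of $R_2,R_3$ is non-empty). For $\mathbf{x}_{k-1}^{\ast}\in R(\mathbf{x}_{k-1})$, $$T(\mathbf{x}_{k-1},\mathbf{x}_{k-1}^{\ast},z_k)=\{(A\mathbf{x}_{k-1}+Bq_1,\ A^{\ast}\mathbf{x}_{k-1}^{\ast}+B^{\ast}q_4):\ \mathbf{q}\in M(C\mathbf{x}_{k-1},(\mathbf{x}_{k-1}^{\ast})_1,z_k),\ A^{\ast}\mathbf{x}_{k-1}^{\ast}+B^{\ast}q_4\neq\mathbf{0}\},$$ and $X(T)=\{\mathbf{x}_k:(\mathbf{x}_k,\mathbf{x}_k^{\ast})\in T\text{ for some }\mathbf{x}_k^{\ast}\}$. The set $X(\mathbf{x}_{k-1},z_k)$ is $X(T(\mathbf{x}_{k-1},\mathbf{x}_{k-1}^{\ast},z_k))$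 for an arbitrarily selected $\mathbf{x}_{k-1}^{\ast}\in R(\mathbf{x}_{k-1})$ (the paper treats it as not depending on this choice).
   Formalization: Proved for m ≥ 2 instead of m ≥ 1: for m = 1 the claim fails, e.g. n = (0,1), d = (1,1), x_0 = 0, z_1 = 0, z_2 = 1, k = 2, where the vertex 1 of S_2 = [-2,1] is reached only from the interior point 0 of S_1 = [-1,1]. *)

theory Defs
  imports "HOL-Analysis.Analysis" "HOL-Computational_Algebra.Polynomial"
begin

text \<open>
  The space \<open>\<real>\<^sup>m\<close> is \<open>real^'m\<close> with \<open>m = CARD('m)\<close>. The order on the index type
  enumerates the coordinates: \<open>pos i \<in> {1..m}\<close> is the usual 1-based number of coordinate \<open>i\<close>.
  The coefficient vectors \<open>(n\<^sub>1, \<dots>, n\<^bsub>m+1\<^esub>)\<close> and \<open>(d\<^sub>1, \<dots>, d\<^bsub>m+1\<^esub>)\<close> are functions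
  \<open>nat \<Rightarrow> real\<close> that are only ever used at the arguments \<open>1, \<dots>, m + 1\<close>.
\<close>

definition pos :: "'m::{finite,linorder} \<Rightarrow> nat" where
  "pos i = card {j. j \<le> i}"

definition first_comp :: "real^'m::{finite,linorder} \<Rightarrow> real" where
  "first_comp x = x $ Min UNIV"

definition coeff_poly :: "nat \<Rightarrow> (nat \<Rightarrow> real) \<Rightarrow> real poly" where
  "coeff_poly m c = (\<Sum>i=1..m+1. monom (c i) (i - 1))"


subsection \<open>Estimation system\<close>

definition A_mat :: "(nat \<Rightarrow> real) \<Rightarrow> real^'m::{finite,linorder}^'m::{finite,linorder}" where
  "A_mat d = (\<chi> i j.
     if pos i = CARD('m) then - d (CARD('m) + 2 - pos j)
     else if pos j = pos i + 1 then 1 else 0)"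

definition B_vec :: "real^'m::{finite,linorder}" where
  "B_vec = (\<chi> i. if pos i = CARD('m) then 1 else 0)"

definition C_vec :: "(nat \<Rightarrow> real) \<Rightarrow> (nat \<Rightarrow> real) \<Rightarrow> real^'m::{finite,linorder}" where
  "C_vec n d = (\<chi> j. n (CARD('m) + 2 - pos j) - n 1 * d (CARD('m) + 2 - pos j))"

definition D1 :: "(nat \<Rightarrow> real) \<Rightarrow> real" where
  "D1 n = n 1"

primrec unc_set ::
  "(nat \<Rightarrow> real) \<Rightarrow> (nat \<Rightarrow> real) \<Rightarrow> (nat \<Rightarrow> real) \<Rightarrow> real^'m::{finite,linorder}
    \<Rightarrow> nat \<Rightarrow> (real^'m::{finite,linorder}) set"
where
  "unc_set n d z x0 0 = {x0}"
| "unc_set n d z x0 (Suc k) =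
     {A_mat d *v x + v *\<^sub>R B_vec | x v.
        x \<in> unc_set n d z x0 k \<and> \<bar>v\<bar> \<le> 1 \<and> \<bar>C_vec n d \<bullet> x + D1 n * v - z (Suc k)\<bar> \<le> 1}"


subsection \<open>Regulator matrices\<close>

definition A_star :: "(nat \<Rightarrow> real) \<Rightarrow> real^'m::{finite,linorder}^'m::{finite,linorder}" where
  "A_star d = (\<chi> i j.
     if pos j = 1 then - d (CARD('m) + 1 - pos i) / d (CARD('m) + 1)
     else if pos j = pos i + 1 then 1 else 0)"

definition B_star :: "(nat \<Rightarrow> real) \<Rightarrow> (nat \<Rightarrow> real) \<Rightarrow> real^'m::{finite,linorder}" where
  "B_star n d = (\<chi> i.
     n (CARD('m) + 1 - pos i)
       - n (CARD('m) + 1) / d (CARD('m) + 1) * d (CARD('m) + 1 - pos i))"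


subsection \<open>Outer normals\<close>

text \<open>The sets are compact, so the supremum is the maximum.\<close>

definition supp_fun :: "(real^'m) set \<Rightarrow> real^'m \<Rightarrow> real" where
  "supp_fun S xs = (SUP x\<in>S. xs \<bullet> x)"

definition C_O :: "(real^'m) set \<Rightarrow> real^'m \<Rightarrow> (real^'m) set" where
  "C_O S x = {xs. xs \<noteq> 0 \<and> xs \<bullet> x = supp_fun S xs}"


subsection \<open>Alignment and the one-step maps\<close>

text \<open>In the following, \<open>zk\<close> is the measurement at the current time.\<close>

definition aligned :: "real \<Rightarrow> real \<Rightarrow> real \<Rightarrow> real \<Rightarrow> real \<Rightarrow> bool" where
  "aligned zk y v ys vs \<longleftrightarrow>
     (vs > 0 \<longrightarrow> v = 1) \<and> (vs < 0 \<longrightarrow> v = -1) \<and> (\<bar>v\<bar> < 1 \<longrightarrow> vs = 0) \<and>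
     (ys > 0 \<longrightarrow> y = 1 + zk) \<and> (ys < 0 \<longrightarrow> y = -1 + zk) \<and> (\<bar>y - zk\<bar> < 1 \<longrightarrow> ys = 0)"

text \<open>Quadruples are ordered \<open>(v, y, v\<^sup>*, y\<^sup>*)\<close>; the argument \<open>m\<close> is the state dimension.\<close>

definition M_set ::
  "nat \<Rightarrow> (nat \<Rightarrow> real) \<Rightarrow> (nat \<Rightarrow> real) \<Rightarrow> real \<Rightarrow> real \<Rightarrow> real \<Rightarrow> (real \<times> real \<times> real \<times> real) set"
where
  "M_set m n d s t zk = {(v, y, vs, ys).
     \<bar>v\<bar> \<le> 1 \<and> \<bar>y - zk\<bar> \<le> 1 \<and> y - n 1 * v = s \<and>
     d (m + 1) * vs + n (m + 1) * ys = - t \<and> aligned zk y v ys vs}"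

definition R_set ::
  "(real^'m::{finite,linorder}) set \<Rightarrow> real^'m::{finite,linorder} \<Rightarrow> (real^'m::{finite,linorder}) set"
where
  "R_set S x =
     (let R1 = {xs \<in> C_O S x. first_comp xs = 0};
          R2 = {xs \<in> C_O S x. first_comp xs > 0};
          R3 = {xs \<in> C_O S x. first_comp xs < 0}
      in if R1 \<noteq> {} then R1 else if R2 \<noteq> {} then R2 else R3)"

definition T_set ::
  "(nat \<Rightarrow> real) \<Rightarrow> (nat \<Rightarrow> real) \<Rightarrow> real^'m::{finite,linorder} \<Rightarrow> real^'m::{finite,linorder}
    \<Rightarrow> real \<Rightarrow> ((real^'m::{finite,linorder}) \<times> (real^'m::{finite,linorder})) set"
where
  "T_set n d x xs zk =
     {(A_mat d *v x + v *\<^sub>R B_vec, A_star d *v xs + ys *\<^sub>R B_star n d) | v y vs ys.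
        (v, y, vs, ys) \<in> M_set CARD('m) n d (C_vec n d \<bullet> x) (first_comp xs) zk \<and>
        A_star d *v xs + ys *\<^sub>R B_star n d \<noteq> 0}"

definition X_of :: "((real^'m) \<times> (real^'m)) set \<Rightarrow> (real^'m) set" where
  "X_of T = {x. \<exists>xs. (x, xs) \<in> T}"

text \<open>
  The set \<open>X(x, z\<^sub>k)\<close> is \<open>X(T(x, x\<^sup>*, z\<^sub>k))\<close> for an arbitrarily selected \<open>x\<^sup>* \<in> R(x)\<close>. So that
  a membership claim does not depend on the selection, membership here means that a selection
  is possible and that the point belongs to \<open>X(T(x, x\<^sup>*, z\<^sub>k))\<close> whichever \<open>x\<^sup>*\<close> is selected.
\<close>

definition X_set ::
  "(nat \<Rightarrow> real) \<Rightarrow> (nat \<Rightarrow> real) \<Rightarrow> (real^'m::{finite,linorder}) set \<Rightarrow> real^'m::{finite,linorder}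
    \<Rightarrow> real \<Rightarrow> (real^'m::{finite,linorder}) set"
where
  "X_set n d S x zk =
     {w. R_set S x \<noteq> {} \<and> (\<forall>xs\<in>R_set S x. w \<in> X_of (T_set n d x xs zk))}"


subsection \<open>The one-dimensional case\<close>

text \<open>
  For \<open>m = 1\<close> a vertex of \<open>S\<^sub>k\<close> can arise from an interior point of \<open>S\<^bsub>k-1\<^esub>\<close> alone, where both
  the noise bound and the measurement bound are active; for \<open>m \<ge> 2\<close> the set \<open>S\<^sub>k\<close> would contain
  a segment around such a point. The data \<open>n = (0, 1)\<close>, \<open>d = (1, 1)\<close>, \<open>x\<^sub>0 = 0\<close>, \<open>z\<^sub>1 = 0\<close>,
  \<open>z\<^sub>2 = 1\<close> satisfy all hypotheses at \<open>k = 2\<close>, with \<open>S\<^sub>1 = [-1, 1]\<close> and \<open>S\<^sub>2 = [-2, 1]\<close>, but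
  the vertex \<open>1\<close> of \<open>S\<^sub>2\<close> does not even lie in \<open>X(T(x, x\<^sup>*, z\<^sub>2))\<close> for any \<open>x \<in> {-1, 1}\<close> and
  any \<open>x\<^sup>*\<close>. Hence statements about vertices of \<open>S\<^sub>k\<close> need \<open>m \<ge> 2\<close>.
\<close>

definition cex_n :: "nat \<Rightarrow> real" where "cex_n i = (if i = 2 then 1 else 0)"
definition cex_d :: "nat \<Rightarrow> real" where "cex_d i = 1"
definition cex_z :: "nat \<Rightarrow> real" where "cex_z i = (if i = 2 then 1 else 0)"

lemma cex_all: "(\<forall>i::1. P i) = P 1" using num1_eq1 by metis
lemma cex_pos: "pos (i::1) = 1"
proof - have "{j::1. j \<le> i} = UNIV" using num1_eq1 by (metis (mono_tags) UNIV_eq_I mem_Collect_eq order_refl)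
  thus ?thesis by (simp add: pos_def) qed
lemma cex_vec_eq: "(x = (y::real^1)) = (x$1 = y$1)" by (simp add: vec_eq_iff cex_all)
lemma cex_A: "(A_mat cex_d *v (x::real^1)) $ 1 = - x$1"
  by (simp add: A_mat_def matrix_vector_mult_def cex_pos cex_d_def UNIV_1)
lemma cex_B: "(B_vec::real^1) $ 1 = 1" by (simp add: B_vec_def cex_pos)
lemma cex_C: "C_vec cex_n cex_d \<bullet> (x::real^1) = x$1"
  by (simp add: C_vec_def inner_vec_def cex_pos cex_n_def cex_d_def UNIV_1)

lemma cex_S1: "unc_set cex_n cex_d cex_z (0::real^1) 1 = {x. \<bar>x$1\<bar> \<le> 1}"
proof -
  have "\<bar>x$1\<bar> \<le> 1 \<Longrightarrow> \<exists>v. (x::real^1) = v *\<^sub>R B_vec \<and> \<bar>v\<bar> \<le> 1" for x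
    by (rule exI[of _ "x$1"]) (simp add: cex_vec_eq cex_B)
  moreover have "unc_set cex_n cex_d cex_z (0::real^1) 1 = {v *\<^sub>R B_vec | v. \<bar>v\<bar> \<le> 1}"
  proof -
    have "unc_set cex_n cex_d cex_z (0::real^1) (Suc 0) = {v *\<^sub>R B_vec | v. \<bar>v\<bar> \<le> 1}"
      unfolding unc_set.simps by (simp add: cex_C D1_def cex_n_def cex_z_def)
    then show ?thesis by simp
  qed
  ultimately show ?thesis by (auto simp: cex_B)
qed

lemma cex_S2: "unc_set cex_n cex_d cex_z (0::real^1) 2 = {x. -2 \<le> x$1 \<and> x$1 \<le> 1}"
proof -
  have "unc_set cex_n cex_d cex_z (0::real^1) 2 = {A_mat cex_d *v x + v *\<^sub>R B_vec | x v.
        \<bar>x$1\<bar> \<le> 1 \<and> \<bar>v\<bar> \<le> 1 \<and> \<bar>x$1 - 1\<bar> \<le> 1}"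
    using cex_S1 by (simp add: numeral_2_eq_2 cex_C D1_def cex_n_def cex_z_def)
  also have "\<dots> = {x. -2 \<le> x$1 \<and> x$1 \<le> 1}"
  proof (intro equalityI subsetI, goal_cases)
    case (1 w) then show ?case by (auto simp: cex_A cex_B)
  next
    case (2 w)
    show ?case
    proof (cases "w$1 \<ge> 0")
      case True then have "w = A_mat cex_d *v 0 + (w$1) *\<^sub>R B_vec" by (simp add: cex_vec_eq cex_A cex_B)
      then show ?thesis using 2 True by (auto intro!: exI[of _ 0] exI[of _ "w$1"])
    next
      case False
      have "w = A_mat cex_d *v (\<chi> i. - w$1/2) + (w$1/2) *\<^sub>R B_vec" by (simp add: cex_vec_eq cex_A cex_B)
      moreover have "\<bar>(\<chi> i. - w$1/2)$(1::1)\<bar> \<le> 1" "\<bar>w$1/2\<bar> \<le> 1"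
         "\<bar>(\<chi> i. - w$1/2)$(1::1) - 1\<bar> \<le> 1" using 2 False by auto
      ultimately show ?thesis by blast
    qed
  qed
  finally show ?thesis .
qed

lemma dimension_one_counterexample:
  "cex_d 1 = 1" "cex_d (CARD(1)+1) \<noteq> 0"
  "coprime (coeff_poly CARD(1) cex_n) (coeff_poly CARD(1) cex_d)"
  "interior (unc_set cex_n cex_d cex_z (0::real^1) (2-1)) \<noteq> {}"
  "(1::real^1) extreme_point_of unc_set cex_n cex_d cex_z 0 2"
  "\<not> (\<exists>x \<in> frontier (unc_set cex_n cex_d cex_z 0 (2 - 1)). \<exists>xs.
         (1::real^1) \<in> X_of (T_set cex_n cex_d x xs (cex_z 2)))"
proof -
  show "cex_d 1 = 1" "cex_d (CARD(1)+1) \<noteq> 0" by (auto simp: cex_d_def)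
  have I: "{1..Suc (Suc 0)} = {1,2}" by auto
  have "coeff_poly 1 cex_n = [:0,1:]" "coeff_poly 1 cex_d = [:1,1:]"
    by (simp_all add: coeff_poly_def cex_n_def cex_d_def I monom_altdef one_pCons)
  moreover have "coprime [:0,1::real:] [:1,1:]"
  proof (rule coprimeI)
    fix c assume "c dvd [:0,1::real:]" "c dvd [:1,1::real:]"
    then have "c dvd [:1,1::real:] - [:0,1:]" by (rule dvd_diff[rotated])
    then show "is_unit c" by (simp add: one_pCons)
  qed
  ultimately show "coprime (coeff_poly CARD(1) cex_n) (coeff_poly CARD(1) cex_d)" by simp
  have op: "open {x::real^1. \<bar>x$1\<bar> < 1}"
    by (intro open_Collect_less continuous_intros)
  have i: "{x::real^1. \<bar>x$1\<bar> < 1} \<subseteq> interior (unc_set cex_n cex_d cex_z 0 1)"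
    unfolding cex_S1 by (rule interior_maximal) (use op in auto)
  moreover have "0 \<in> {x::real^1. \<bar>x$1\<bar> < 1}" by simp
  ultimately have "interior (unc_set cex_n cex_d cex_z (0::real^1) 1) \<noteq> {}" by blast
  then show "interior (unc_set cex_n cex_d cex_z (0::real^1) (2-1)) \<noteq> {}" by (simp del: unc_set.simps)
  show "(1::real^1) extreme_point_of unc_set cex_n cex_d cex_z 0 2"
    unfolding cex_S2 extreme_point_of_def
  proof (intro conjI ballI notI, simp)
    fix a b assume a: "a \<in> {x::real^1. -2 \<le> x$1 \<and> x$1 \<le> 1}" and b: "b \<in> {x::real^1. -2 \<le> x$1 \<and> x$1 \<le> 1}"
      and "1 \<in> open_segment a b"
    then obtain u where u: "a$1 \<noteq> b$1" "0 < u" "u < 1" "1 = (1-u) * a$1 + u * b$1"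
      by (auto simp: in_segment cex_vec_eq)
    have "(1-u) * a$1 \<le> 1-u" "u * b$1 \<le> u"
      using a b u by (auto simp: mult_left_le)
    then have "(1-u) * a$1 = 1-u" "u * b$1 = u" using u by linarith+
    then show False using u by auto
  qed
  have fr: "\<bar>x$1\<bar> = 1" if "x \<in> frontier (unc_set cex_n cex_d cex_z (0::real^1) 1)" for x
  proof -
    have "closed (unc_set cex_n cex_d cex_z (0::real^1) 1)"
      unfolding cex_S1 by (intro closed_Collect_le continuous_intros)
    then have "x \<in> unc_set cex_n cex_d cex_z (0::real^1) 1" using that frontier_subset_closed by blast
    moreover have "x \<notin> {x::real^1. \<bar>x$1\<bar> < 1}" using that i by (auto simp: frontier_def)
    ultimately show ?thesis unfolding cex_S1 by auto
  qed
  show "\<not> (\<exists>x \<in> frontier (unc_set cex_n cex_d cex_z 0 (2 - 1)). \<exists>xs.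
         (1::real^1) \<in> X_of (T_set cex_n cex_d x xs (cex_z 2)))"
  proof clarify
    fix x xs assume x: "x \<in> frontier (unc_set cex_n cex_d cex_z 0 (2 - 1))"
      and "(1::real^1) \<in> X_of (T_set cex_n cex_d x xs (cex_z 2))"
    then obtain v y where "1 = A_mat cex_d *v x + v *\<^sub>R B_vec" "\<bar>v\<bar> \<le> 1" "\<bar>y-1\<bar> \<le> 1" "y = x$1"
      by (auto simp: X_of_def T_set_def M_set_def cex_C cex_n_def cex_z_def)
    moreover have "\<bar>x$1\<bar> = 1" using fr x by simp
    ultimately show False by (auto simp: cex_vec_eq cex_A cex_B)
  qed
qed

end

theory Submission
  imports Defs
begin

text \<open>
  The regulator is the adjoint of the estimation system: for \<open>w = A\<^sup>* x\<^sup>* + y\<^sup>* B\<^sup>*\<close> and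
  \<open>d\<^bsub>m+1\<^esub> v\<^sup>* + n\<^bsub>m+1\<^esub> y\<^sup>* = - (x\<^sup>*)\<^sub>1\<close> one has \<open>\<langle>w, A x + B v\<rangle> = \<langle>x\<^sup>*, x\<rangle> + y\<^sup>* y + v\<^sup>* v\<close>.
  So if \<open>x\<^sup>*\<close> is an outer normal of \<open>S\<^bsub>k-1\<^esub>\<close> at \<open>x\<close> and the scalars are aligned, then \<open>w\<close>, when
  nonzero, is an outer normal of \<open>S\<^sub>k\<close> at \<open>A x + B v\<close>.

  Write a vertex as \<open>A x + B v\<close> with a feasible pair \<open>(x, v)\<close>. As \<open>m \<ge> 2\<close>, a direction orthogonal to
  \<open>C\<close> shows that \<open>x\<close> is not interior. If \<open>(x\<^sup>*)\<^sub>1 = 0\<close>, then \<open>v\<^sup>* = y\<^sup>* = 0\<close> works. Otherwise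
  \<open>R\<^sub>1 = {}\<close>, so the line through \<open>x\<close> in the first coordinate direction meets the interior. All
  its points reach the same vertex, with \<open>v\<close> and \<open>y\<close> varying affinely; the interior ones are
  infeasible, so the bound on \<open>v\<close> or the bound on \<open>y\<close> is active at \<open>x\<close> on the side of the
  interior, which yields aligned multipliers of the required sign.
\<close>

subsection \<open>Coordinates\<close>

lemma pos_le_CARD: "pos (i::'m::{finite,linorder}) \<le> CARD('m)"
  unfolding pos_def by (rule card_mono) auto

lemma pos_ge_1: "1 \<le> pos (i::'m::{finite,linorder})"
proof -
  have "card {i} \<le> card {j. j \<le> i}" by (rule card_mono) auto
  then show ?thesis by (simp add: pos_def)
qed

lemma pos_strict_mono: "i < j \<Longrightarrow> pos i < pos (j::'m::{finite,linorder})"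
proof -
  assume "i < j"
  then have "j \<in> {l. l \<le> j} - {l. l \<le> i}" "{l. l \<le> i} \<subseteq> {l. l \<le> j}" by auto
  then show "pos i < pos j" unfolding pos_def by (intro psubset_card_mono) auto
qed

lemma pos_eq_iff [simp]: "pos i = pos j \<longleftrightarrow> i = (j::'m::{finite,linorder})"
  by (metis less_irrefl neqE pos_strict_mono)

lemma pos_surj:
  assumes "1 \<le> p" "p \<le> CARD('m)"
  obtains i :: "'m::{finite,linorder}" where "pos i = p"
proof -
  have "inj (pos :: 'm \<Rightarrow> nat)" by (auto intro: injI)
  then have "card (range (pos :: 'm \<Rightarrow> nat)) = CARD('m)" by (rule card_image)
  moreover have "range (pos :: 'm \<Rightarrow> nat) \<subseteq> {1..CARD('m)}"
    using pos_ge_1 pos_le_CARD by auto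
  ultimately have "range (pos :: 'm \<Rightarrow> nat) = {1..CARD('m)}"
    by (intro card_subset_eq) auto
  with assms that show thesis by (metis atLeastAtMost_iff imageE)
qed

lemma pos_Min [simp]: "pos (Min UNIV :: 'm::{finite,linorder}) = Suc 0"
proof -
  have "{j::'m. j \<le> Min UNIV} = {Min UNIV}" by (auto intro: antisym)
  then show ?thesis by (simp add: pos_def)
qed

lemma pos_eq_1_iff [simp]: "pos i = Suc 0 \<longleftrightarrow> i = (Min UNIV :: 'm::{finite,linorder})"
  by (metis pos_eq_iff pos_Min)

lemma pos_nonzero [simp]: "pos (i::'m::{finite,linorder}) \<noteq> 0"
  using pos_ge_1[of i] by simp

lemma sum_if_pos:
  fixes j :: "'m::{finite,linorder}"
  assumes "pos j = p"
  shows "(\<Sum>i\<in>UNIV. if pos i = p then f i else (0::real)) = f j"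
  using assms by (auto simp: sum.delta)

lemma B_vec_nonzero: "(B_vec :: real^'m::{finite,linorder}) \<noteq> 0"
proof -
  obtain l :: 'm where "pos l = CARD('m)" by (rule pos_surj[of "CARD('m)"]) auto
  then show ?thesis by (auto simp: B_vec_def vec_eq_iff)
qed

text \<open>The first column of \<open>A_mat\<close> is supported in the last row, so a displacement
  of the state along the first axis can be undone by the input.\<close>

lemma A_mat_first_axis:
  "A_mat d *v axis (Min UNIV) 1 = - d (CARD('m) + 1) *\<^sub>R (B_vec :: real^'m::{finite,linorder})"
  by (auto simp: vec_eq_iff matrix_vector_mul_component inner_axis A_mat_def B_vec_def)

lemma C_vec_first_axis:
  "C_vec n d \<bullet> axis (Min UNIV :: 'm) 1 = n (CARD('m::{finite,linorder}) + 1) - n 1 * d (CARD('m) + 1)"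
  by (simp add: inner_axis C_vec_def)

subsection \<open>Duality of the two systems\<close>

text \<open>Dividing the multiplier equation by \<open>d (CARD('m) + 1)\<close> rewrites the first
  column of \<open>A_star\<close> in terms of \<open>vs\<close> and \<open>ys\<close>; its
  \<open>ys\<close> part cancels the quotient term of \<open>B_star\<close>, and a pure shift
  remains.\<close>

lemma regulator_component:
  fixes xs :: "real^'m::{finite,linorder}"
  assumes "d (CARD('m) + 1) \<noteq> 0"
    and "d (CARD('m) + 1) * vs + n (CARD('m) + 1) * ys = - first_comp xs"
  shows "(A_star d *v xs + ys *\<^sub>R B_star n d) $ i =
    (\<Sum>l\<in>UNIV. if pos l = pos i + 1 then xs $ l else 0)
      + d (CARD('m) + 1 - pos i) * vs + n (CARD('m) + 1 - pos i) * ys"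
proof -
  let ?D = "d (CARD('m) + 1)" and ?q = "CARD('m) + 1 - pos i"
  have "(A_star d *v xs) $ i =
      (\<Sum>l\<in>UNIV. (if pos l = 1 then - d ?q / ?D * xs $ l else 0)
        + (if pos l = pos i + 1 then xs $ l else 0))"
    unfolding matrix_vector_mult_def A_star_def
    by (auto intro!: sum.cong)
  also have "\<dots> = - d ?q / ?D * first_comp xs + (\<Sum>l\<in>UNIV. if pos l = pos i + 1 then xs $ l else 0)"
    unfolding sum.distrib first_comp_def by simp
  finally have "(A_star d *v xs) $ i = \<dots>" .
  moreover have "- d ?q / ?D * first_comp xs = d ?q * vs + d ?q * (n (CARD('m) + 1) / ?D) * ys"
  proof -
    have "- first_comp xs / ?D = vs + n (CARD('m) + 1) / ?D * ys"
      using assms by (simp add: field_simps flip: assms(2))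
    then have "d ?q * (- first_comp xs / ?D) = d ?q * (vs + n (CARD('m) + 1) / ?D * ys)" by simp
    then show ?thesis by (simp add: algebra_simps)
  qed
  ultimately show ?thesis by (simp add: B_star_def algebra_simps)
qed

lemma step_adjoint:
  fixes x xs :: "real^'m::{finite,linorder}"
  assumes "d 1 = 1" "d (CARD('m) + 1) \<noteq> 0"
    and "d (CARD('m) + 1) * vs + n (CARD('m) + 1) * ys = - first_comp xs"
  shows "(A_star d *v xs + ys *\<^sub>R B_star n d) \<bullet> (A_mat d *v x + v *\<^sub>R B_vec)
    = xs \<bullet> x + ys * (C_vec n d \<bullet> x + n 1 * v) + vs * v"
proof -
  define w where "w = A_star d *v xs + ys *\<^sub>R B_star n d"
  have w: "w $ i = (\<Sum>l\<in>UNIV. if pos l = pos i + 1 then xs $ l else 0)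
      + d (CARD('m) + 1 - pos i) * vs + n (CARD('m) + 1 - pos i) * ys" for i
    unfolding w_def by (rule regulator_component[where d = d and n = n, OF assms(2,3)])
  obtain l :: 'm where l: "pos l = CARD('m)" by (rule pos_surj[of "CARD('m)"]) auto
  \<comment> \<open>The shift brings nothing into the last coordinate, as no position follows
    it.\<close>
  have "pos i \<noteq> CARD('m) + 1" for i :: 'm using pos_le_CARD[of i] by simp
  then have wl: "w $ l = vs + n 1 * ys" by (simp add: w l assms(1)[unfolded One_nat_def])
  have wB: "w \<bullet> B_vec = w $ l"
    unfolding inner_vec_def B_vec_def using sum_if_pos[OF l, of "\<lambda>i. w $ i"]
    by (simp add: if_distrib[of "(*) _"] cong: if_cong)
  \<comment> \<open>Together with the value of \<open>w \<bullet> B_vec\<close>, this transposed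
    equation is the whole adjoint identity.\<close>
  have "transpose (A_mat d) *v w = xs + ys *\<^sub>R C_vec n d"
  proof (intro vec_eq_iff[THEN iffD2] allI)
    fix j :: 'm
    have j: "1 \<le> pos j" "pos j \<le> CARD('m)" by (rule pos_ge_1, rule pos_le_CARD)
    have "(transpose (A_mat d) *v w) $ j =
      (\<Sum>i\<in>UNIV. (if pos i = CARD('m) then - d (CARD('m) + 2 - pos j) * w $ i else 0)
        + (if pos i = pos j - 1 then w $ i else 0))"
      unfolding matrix_vector_mult_def transpose_def A_mat_def using j
      by (auto intro!: sum.cong)
    also have "\<dots> = - d (CARD('m) + 2 - pos j) * w $ l
        + (\<Sum>i\<in>UNIV. if pos i = pos j - 1 then w $ i else 0)"
      unfolding sum.distrib sum_if_pos[OF l] ..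
    also have "\<dots> = xs $ j + ys * (n (CARD('m) + 2 - pos j) - n 1 * d (CARD('m) + 2 - pos j))"
    \<comment> \<open>The superdiagonal sum is empty for the first coordinate; there the multiplier
      equation supplies \<open>first_comp xs\<close>.\<close>
    proof (cases "pos j = 1")
      case True
      then have "first_comp xs = xs $ j" by (simp add: first_comp_def)
      then show ?thesis using True assms(3) by (simp add: wl algebra_simps)
    next
      case False
      then obtain i :: 'm where i: "pos i = pos j - 1"
        using j by (metis pos_surj[of "pos j - 1", where 'm = 'm] One_nat_def diff_le_self le_trans
            Suc_leI le_neq_implies_less zero_less_diff)
      then have ij: "pos j = pos i + 1" using j by simp
      have "w $ i = xs $ j + d (CARD('m) + 1 - pos i) * vs + n (CARD('m) + 1 - pos i) * ys"
        unfolding w ij[symmetric] by (subst sum_if_pos[OF refl]) simp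
      then show ?thesis
        using sum_if_pos[OF i, of "\<lambda>i. w $ i"] by (simp add: wl ij algebra_simps)
    qed
    finally show "(transpose (A_mat d) *v w) $ j = (xs + ys *\<^sub>R C_vec n d) $ j"
      by (simp add: C_vec_def)
  qed
  moreover have "w \<bullet> (A_mat d *v x) = (transpose (A_mat d) *v w) \<bullet> x"
    by (metis dot_lmul_matrix transpose_matrix_vector)
  ultimately have "w \<bullet> (A_mat d *v x) = xs \<bullet> x + ys * (C_vec n d \<bullet> x)"
    by (simp add: inner_left_distrib)
  then have "w \<bullet> (A_mat d *v x + v *\<^sub>R B_vec)
      = xs \<bullet> x + ys * (C_vec n d \<bullet> x) + v * (vs + n 1 * ys)"
    by (simp add: inner_right_distrib wB wl)
  then show ?thesis unfolding w_def by (simp add: algebra_simps)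
qed

text \<open>Apply the adjoint identity with \<open>n = 0\<close>, \<open>ys = 0\<close>,
  \<open>v = 0\<close> and \<open>u\<close> as both state and normal: the left side vanishes and the
  right side is \<open>u \<bullet> u\<close>. The value of \<open>vs\<close> solves the multiplier
  equation.\<close>

lemma A_mat_inj:
  fixes u :: "real^'m::{finite,linorder}"
  assumes "d 1 = 1" "d (CARD('m) + 1) \<noteq> 0" "A_mat d *v u = 0"
  shows "u = 0"
proof -
  have "u \<bullet> u = 0"
    using step_adjoint[OF assms(1,2), of "- first_comp u / d (CARD('m) + 1)" "\<lambda>_. 0" 0 u u 0] assms(2,3)
    by simp
  then show ?thesis by simp
qed

subsection \<open>Convex sets and outer normals\<close>

text \<open>Boundedness makes the \<open>SUP\<close> in \<open>supp_fun\<close> a genuine upper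
  bound, so equality with it means maximality.\<close>

lemma C_O_iff:
  assumes "bounded S" "x \<in> S"
  shows "xs \<in> C_O S x \<longleftrightarrow> xs \<noteq> 0 \<and> (\<forall>y\<in>S. xs \<bullet> y \<le> xs \<bullet> x)"
proof -
  have "bounded ((\<bullet>) xs ` S)"
    using assms(1) bounded_linear_inner_right by (rule bounded_linear_image)
  then have bdd: "bdd_above ((\<bullet>) xs ` S)" by (rule bounded_imp_bdd_above)
  have "xs \<bullet> x = supp_fun S xs \<longleftrightarrow> (\<forall>y\<in>S. xs \<bullet> y \<le> xs \<bullet> x)"
  proof
    show "xs \<bullet> x = supp_fun S xs \<Longrightarrow> \<forall>y\<in>S. xs \<bullet> y \<le> xs \<bullet> x"
      unfolding supp_fun_def using cSUP_upper[OF _ bdd] by auto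
    assume "\<forall>y\<in>S. xs \<bullet> y \<le> xs \<bullet> x"
    then have "Sup ((\<bullet>) xs ` S) = xs \<bullet> x"
      using assms(2) by (intro cSup_eq_maximum) auto
    then show "xs \<bullet> x = supp_fun S xs" by (simp add: supp_fun_def)
  qed
  then show ?thesis by (auto simp: C_O_def)
qed

text \<open>Separate \<open>T\<close> from the interior of \<open>S\<close>; the weak inequality
  extends to \<open>S\<close>, which lies in the closure of its interior.\<close>

lemma convex_disjoint_interior_normal:
  fixes S T :: "'a::euclidean_space set"
  assumes "convex S" "interior S \<noteq> {}" "convex T" "T \<noteq> {}" "T \<inter> interior S = {}"
  obtains a where "a \<noteq> 0" "\<forall>t\<in>T. \<forall>y\<in>S. a \<bullet> y \<le> a \<bullet> t"
proof -
  obtain a b where a: "a \<noteq> 0" "\<forall>y\<in>interior S. a \<bullet> y \<le> b" "\<forall>t\<in>T. b \<le> a \<bullet> t"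
    using separating_hyperplane_sets[of "interior S" T] assms convex_interior by blast
  have "closure (interior S) \<subseteq> {y. a \<bullet> y \<le> b}"
    using a(2) by (intro closure_minimal) (auto simp: closed_halfspace_le)
  then have "S \<subseteq> {y. a \<bullet> y \<le> b}"
    using convex_closure_interior[OF assms(1,2)] closure_subset by fast
  then show thesis using a by (intro that[of a]) fastforce+
qed

lemma extreme_point_symmetric:
  fixes h :: "'a::real_vector"
  assumes "p extreme_point_of S" "p + h \<in> S" "p - h \<in> S"
  shows "h = 0"
proof (rule ccontr)
  assume "h \<noteq> 0"
  then have "h + h \<noteq> 0" by (simp flip: scaleR_2)
  then have "p - h \<noteq> p + h" by (simp add: diff_eq_eq add.assoc)
  moreover have "p = midpoint (p - h) (p + h)" by (simp add: midpoint_def scaleR_2[symmetric])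
  ultimately have "p \<in> open_segment (p - h) (p + h)" by (metis midpoint_in_open_segment)
  with assms show False by (auto simp: extreme_point_of_def)
qed

subsection \<open>One step of the estimation system\<close>

text \<open>The recursion step as an operator on arbitrary sets, so that later arguments use only
  convexity, boundedness and interior of \<open>S\<close>.\<close>

definition step_set ::
  "(nat \<Rightarrow> real) \<Rightarrow> (nat \<Rightarrow> real) \<Rightarrow> real \<Rightarrow> (real^'m::{finite,linorder}) set
    \<Rightarrow> (real^'m::{finite,linorder}) set"
where
  "step_set n d zk S = {A_mat d *v x + v *\<^sub>R B_vec | x v.
     x \<in> S \<and> \<bar>v\<bar> \<le> 1 \<and> \<bar>C_vec n d \<bullet> x + n 1 * v - zk\<bar> \<le> 1}"

lemma unc_set_Suc: "unc_set n d z x0 (Suc k) = step_set n d (z (Suc k)) (unc_set n d z x0 k)"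
  by (simp add: step_set_def D1_def)

lemma step_set_I:
  assumes "x \<in> S" "\<bar>v\<bar> \<le> 1" "\<bar>C_vec n d \<bullet> x + n 1 * v - zk\<bar> \<le> 1"
  shows "A_mat d *v x + v *\<^sub>R B_vec \<in> step_set n d zk S"
  using assms unfolding step_set_def by blast

lemma bounded_step_set:
  fixes S :: "(real^'m::{finite,linorder}) set"
  assumes "bounded S"
  shows "bounded (step_set n d zk S)"
proof -
  have "bounded ((*v) (A_mat d) ` S)"
    using assms matrix_vector_mul_bounded_linear by (rule bounded_linear_image)
  moreover have "bounded ((\<lambda>v. v *\<^sub>R (B_vec :: real^'m::{finite,linorder})) ` {-1..1})"
    by (intro bounded_linear_image bounded_linear_scaleR_left) simp
  ultimately have "bounded (\<Union>a\<in>(*v) (A_mat d) ` S. \<Union>b\<in>(\<lambda>v. v *\<^sub>R (B_vec :: real^'m::{finite,linorder})) ` {-1..1}. {a + b})"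
    by (rule bounded_sums)
  then show ?thesis
    by (rule bounded_subset) (fastforce simp: step_set_def abs_le_iff)
qed

text \<open>The feasible pairs form a slab of \<open>S\<close> times an interval, and the step is a
  linear image of them.\<close>

lemma convex_step_set:
  fixes S :: "(real^'m::{finite,linorder}) set"
  assumes "convex S"
  shows "convex (step_set n d zk S)"
proof -
  let ?f = "\<lambda>p::(real^'m::{finite,linorder}) \<times> real. A_mat d *v fst p + snd p *\<^sub>R B_vec"
  let ?g = "\<lambda>p::(real^'m::{finite,linorder}) \<times> real. C_vec n d \<bullet> fst p + n 1 * snd p"
  have f: "linear ?f"
    by (intro linearI) (simp_all add: algebra_simps matrix_vector_right_distrib matrix_vector_mult_scaleR)
  have g: "linear ?g"
    by (intro linearI) (simp_all add: algebra_simps inner_right_distrib)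
  have "convex ((S \<times> {-1..1}) \<inter> ?g -` {zk - 1..zk + 1})"
    by (intro convex_Int convex_Times assms convex_linear_vimage g) auto
  then have "convex (?f ` ((S \<times> {-1..1}) \<inter> ?g -` {zk - 1..zk + 1}))"
    by (rule convex_linear_image[OF f])
  also have "?f ` ((S \<times> {-1..1}) \<inter> ?g -` {zk - 1..zk + 1}) = step_set n d zk S"
  proof -
    have *: "v \<in> {-1..1} \<longleftrightarrow> \<bar>v\<bar> \<le> 1" "y \<in> {zk - 1..zk + 1} \<longleftrightarrow> \<bar>y - zk\<bar> \<le> 1" for v y :: real
      by auto
    show ?thesis
      unfolding step_set_def image_def Bex_def Int_iff vimage_eq mem_Times_iff * split_paired_Ex
        fst_conv snd_conv
      by (intro Collect_cong) blast
  qed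
  finally show ?thesis .
qed

lemma bounded_unc_set: "bounded (unc_set n d z x0 k)"
  by (induction k) (simp_all add: unc_set_Suc bounded_step_set del: unc_set.simps(2))

lemma convex_unc_set: "convex (unc_set n d z x0 k)"
  by (induction k) (simp_all add: unc_set_Suc convex_step_set del: unc_set.simps(2))

text \<open>For \<open>b\<close> in [-1,1] this says that \<open>c\<close> is zero or an outer
  normal of that interval at \<open>b\<close>. It treats \<open>v\<close> and \<open>y - zk\<close>
  uniformly.\<close>

definition active :: "real \<Rightarrow> real \<Rightarrow> bool" where
  "active b c \<longleftrightarrow> (c > 0 \<longrightarrow> b = 1) \<and> (c < 0 \<longrightarrow> b = -1) \<and> (\<bar>b\<bar> < 1 \<longrightarrow> c = 0)"

lemma aligned_iff_active: "aligned zk y v ys vs \<longleftrightarrow> active v vs \<and> active (y - zk) ys"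
proof -
  have "y = 1 + zk \<longleftrightarrow> y - zk = 1" "y = -1 + zk \<longleftrightarrow> y - zk = -1" by linarith+
  then show ?thesis unfolding aligned_def active_def by blast
qed

lemma active_mult_le:
  assumes "active b c" "\<bar>b'\<bar> \<le> 1"
  shows "c * b' \<le> c * b"
proof (cases c "0::real" rule: linorder_cases)
  case less
  then have "b \<le> b'" using assms by (simp add: active_def)
  then show ?thesis using less by (simp add: mult_left_mono_neg)
next
  case greater
  then have "b' \<le> b" using assms by (simp add: active_def)
  then show ?thesis using greater by (simp add: mult_left_mono)
qed simp

lemma active_scale:
  assumes "active b c" "r > 0"
  shows "active b (r * c)"
proof -
  have "r * c > 0 \<longleftrightarrow> c > 0" "r * c < 0 \<longleftrightarrow> c < 0" "r * c = 0 \<longleftrightarrow> c = 0"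
    using assms(2) by (auto simp: zero_less_mult_iff mult_less_0_iff)
  then show ?thesis using assms(1) unfolding active_def by blast
qed

lemma activeI:
  assumes "c = 0 \<or> \<bar>b\<bar> = 1 \<and> b * c > 0"
  shows "active b c"
proof -
  consider "c = 0" | "b = 1" "c > 0" | "b = -1" "c < 0"
    using assms by (auto simp: abs_if zero_less_mult_iff split: if_splits)
  then show ?thesis by cases (simp_all add: active_def)
qed

text \<open>The adjoint identity splits the functional into a state, an output and an input term.
  Each is maximal at the given data: the first because \<open>xs\<close> is a normal, the others by
  alignment.\<close>

lemma outer_normal_step:
  fixes S :: "(real^'m::{finite,linorder}) set"
  assumes "d 1 = 1" "d (CARD('m) + 1) \<noteq> 0" "bounded S" "x \<in> S" "xs \<in> C_O S x"
    and M: "(v, y, vs, ys) \<in> M_set CARD('m) n d (C_vec n d \<bullet> x) (first_comp xs) zk"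
    and nz: "A_star d *v xs + ys *\<^sub>R B_star n d \<noteq> 0"
  shows "A_star d *v xs + ys *\<^sub>R B_star n d \<in> C_O (step_set n d zk S) (A_mat d *v x + v *\<^sub>R B_vec)"
proof -
  from M have v: "\<bar>v\<bar> \<le> 1" and y: "\<bar>y - zk\<bar> \<le> 1" and yeq: "y = C_vec n d \<bullet> x + n 1 * v"
    and t: "d (CARD('m) + 1) * vs + n (CARD('m) + 1) * ys = - first_comp xs"
    and al: "aligned zk y v ys vs"
    by (auto simp: M_set_def)
  let ?w = "A_star d *v xs + ys *\<^sub>R B_star n d"
  note adj = step_adjoint[where d = d and n = n, OF assms(1,2) t]
  have "?w \<bullet> p \<le> ?w \<bullet> (A_mat d *v x + v *\<^sub>R B_vec)" if p: "p \<in> step_set n d zk S" for p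
  proof -
    obtain x' v' where p: "p = A_mat d *v x' + v' *\<^sub>R B_vec" "x' \<in> S" "\<bar>v'\<bar> \<le> 1"
      "\<bar>C_vec n d \<bullet> x' + n 1 * v' - zk\<bar> \<le> 1" using p unfolding step_set_def by blast
    have "xs \<bullet> x' \<le> xs \<bullet> x" using assms(3-5) p(2) by (simp add: C_O_iff)
    moreover have "vs * v' \<le> vs * v" using al p(3) by (simp add: aligned_iff_active active_mult_le)
    moreover have "ys * (C_vec n d \<bullet> x' + n 1 * v' - zk) \<le> ys * (y - zk)"
      using al p(4) unfolding aligned_iff_active by (blast intro: active_mult_le)
    ultimately show ?thesis unfolding p(1) adj yeq by (simp add: algebra_simps)
  qed
  moreover have "A_mat d *v x + v *\<^sub>R B_vec \<in> step_set n d zk S"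
    using assms(4) v y yeq by (intro step_set_I) auto
  ultimately show ?thesis
    using nz bounded_step_set[OF assms(3)] by (simp add: C_O_iff)
qed

section \<open>Selected normals and the first coordinate direction\<close>

lemma C_O_split_first_comp:
  "C_O S x = {a \<in> C_O S x. first_comp a = 0} \<union> {a \<in> C_O S x. first_comp a > 0}
    \<union> {a \<in> C_O S x. first_comp a < 0}"
  by auto

lemma R_set_subset:
  fixes x :: "real^'m::{finite,linorder}"
  shows "R_set S x \<subseteq> C_O S x"
proof -
  have "(if A \<noteq> {} then A else if B \<noteq> {} then B else C) \<subseteq> A \<union> B \<union> C"
    for A B C :: "(real^'m::{finite,linorder}) set" by auto
  from this[of "{a \<in> C_O S x. first_comp a = 0}" "{a \<in> C_O S x. first_comp a > 0}"
      "{a \<in> C_O S x. first_comp a < 0}"]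
  show ?thesis unfolding R_set_def Let_def C_O_split_first_comp[symmetric] .
qed

lemma R_set_empty_iff:
  fixes x :: "real^'m::{finite,linorder}"
  shows "R_set S x = {} \<longleftrightarrow> C_O S x = {}"
proof -
  have "(if A \<noteq> {} then A else if B \<noteq> {} then B else C) = {} \<longleftrightarrow> A \<union> B \<union> C = {}"
    for A B C :: "(real^'m::{finite,linorder}) set" by auto
  from this[of "{a \<in> C_O S x. first_comp a = 0}" "{a \<in> C_O S x. first_comp a > 0}"
      "{a \<in> C_O S x. first_comp a < 0}"]
  show ?thesis unfolding R_set_def Let_def C_O_split_first_comp[symmetric] .
qed

text \<open>\<open>R_set\<close> prefers normals with zero first component, so selecting another
  kind shows that none exist.\<close>

lemma R_set_first_comp_nonzero:
  assumes "xs \<in> R_set S x" "first_comp xs \<noteq> 0" "a \<in> C_O S x"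
  shows "first_comp a \<noteq> 0"
proof
  assume "first_comp a = 0"
  then have "{b \<in> C_O S x. first_comp b = 0} \<noteq> {}" using assms(3) by blast
  then have "R_set S x = {b \<in> C_O S x. first_comp b = 0}" by (simp only: R_set_def Let_def if_True simp_thms)
  with assms(1,2) show False by blast
qed

text \<open>A line missing the interior could be separated from \<open>S\<close>. The separating
  vector would be a normal at \<open>x\<close>, yet bounded below along the line, forcing its first
  component to vanish.\<close>

lemma first_axis_meets_interior:
  fixes S :: "(real^'m::{finite,linorder}) set"
  assumes "convex S" "bounded S" "interior S \<noteq> {}" "x \<in> S"
    and nz: "\<And>a. a \<in> C_O S x \<Longrightarrow> first_comp a \<noteq> 0"
  obtains s where "x + s *\<^sub>R axis (Min UNIV) 1 \<in> interior S"
proof (rule ccontr)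
  let ?L = "range (\<lambda>s. x + s *\<^sub>R axis (Min UNIV) (1::real))"
  assume "\<not> thesis"
  then have disj: "?L \<inter> interior S = {}" using that by auto
  have "convex ?L"
  proof -
    have "convex (range (\<lambda>s. s *\<^sub>R axis (Min UNIV :: 'm) (1::real)))"
      by (intro convex_linear_image linear_scaleR_left convex_UNIV)
    then have "convex ((+) x ` range (\<lambda>s. s *\<^sub>R axis (Min UNIV :: 'm) (1::real)))"
      by (rule convex_translation)
    then show ?thesis by (simp add: image_image)
  qed
  then obtain a where a: "a \<noteq> 0" "\<forall>t\<in>?L. \<forall>y\<in>S. a \<bullet> y \<le> a \<bullet> t"
    using convex_disjoint_interior_normal[OF assms(1,3) _ _ disj] by blast
  have le: "a \<bullet> y \<le> a \<bullet> x + s * first_comp a" if "y \<in> S" for y s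

  proof -
    have "a \<bullet> y \<le> a \<bullet> (x + s *\<^sub>R axis (Min UNIV) 1)" using a(2) that by blast
    then show ?thesis by (simp add: inner_right_distrib inner_axis first_comp_def)
  qed
  have "a \<in> C_O S x"
    using a(1) le[where s=0] assms(2,4) by (simp add: C_O_iff)
  then have "first_comp a \<noteq> 0" by (rule nz)
  \<comment> \<open>This \<open>s\<close> lowers the right side by exactly 1, so
    \<open>y = x\<close> gives a contradiction.\<close>
  then show False using le[OF assms(4), of "- 1 / first_comp a"] by simp
qed

lemma outer_normal_interior_less:
  fixes S :: "(real^'m) set"
  assumes "bounded S" "x \<in> S" "xs \<in> C_O S x" "p \<in> interior S"
  shows "xs \<bullet> p < xs \<bullet> x"
proof -
  have xs: "xs \<noteq> 0" "\<And>y. y \<in> S \<Longrightarrow> xs \<bullet> y \<le> xs \<bullet> x" using assms(1-3) by (auto simp: C_O_iff)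
  obtain e where e: "e > 0" "cball p e \<subseteq> S" using assms(4) mem_interior_cball by blast
  \<comment> \<open>A step of length \<open>e\<close> in direction \<open>xs\<close> stays in
    \<open>S\<close> and strictly increases the functional.\<close>
  have "p + (e / norm xs) *\<^sub>R xs \<in> cball p e" using e(1) xs(1) by (simp add: dist_norm)
  then have "xs \<bullet> (p + (e / norm xs) *\<^sub>R xs) \<le> xs \<bullet> x" using e(2) xs(2) by blast
  moreover have "e / norm xs * (xs \<bullet> xs) > 0" using e(1) xs(1) by simp
  ultimately show ?thesis by (simp add: inner_right_distrib)
qed

text \<open>For a scalar \<open>b\<close> at its bound, \<open>D\<close> is its rate along the first
  axis, \<open>s\<close> a displacement into the interior and \<open>t\<close> the first component
  of the normal. \<open>D * s\<close> has the sign of \<open>b\<close>, and \<open>t\<close> opposes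
  \<open>s\<close>, so \<open>- t / D\<close> is a multiplier of the right sign.\<close>

lemma active_sign:
  fixes b :: real
  assumes "b * (D * s) > 0" "s * t < 0"
  shows "b * (- t / D) > 0"
proof -
  have "D \<noteq> 0" "s \<noteq> 0" using assms by auto
  then have "b * (- t / D) = (b * (D * s)) * (- (s * t)) / (D * s)\<^sup>2"
    by (simp add: power2_eq_square)
  also have "\<dots> > 0" using assms \<open>D \<noteq> 0\<close> \<open>s \<noteq> 0\<close>
    by (intro divide_pos_pos mult_pos_pos[of "b * (D * s)"]) auto
  finally show ?thesis .
qed

text \<open>Only leaving outward from an endpoint is excluded: a strict bound survives by
  continuity, and an inward step shorter than 1 stays inside.\<close>

lemma affine_stays_bounded:
  fixes v c :: real
  assumes "\<bar>v\<bar> \<le> 1" "\<not> (\<bar>v\<bar> = 1 \<and> v * c > 0)"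
  shows "eventually (\<lambda>r. \<bar>v + r * c\<bar> \<le> 1) (at_right 0)"
proof (cases "\<bar>v\<bar> = 1")
  case False
  then have "\<bar>v + 0 * c\<bar> < 1" using assms by simp
  moreover have "((\<lambda>r. \<bar>v + r * c\<bar>) \<longlongrightarrow> \<bar>v + 0 * c\<bar>) (at_right 0)" by (intro tendsto_intros)
  ultimately have "eventually (\<lambda>r. \<bar>v + r * c\<bar> < 1) (at_right 0)" by (rule order_tendstoD(2)[rotated])
  then show ?thesis by eventually_elim simp
next
  case True
  have "((\<lambda>r. r * c) \<longlongrightarrow> 0 * c) (at_right 0)" by (intro tendsto_intros)
  then have "((\<lambda>r. \<bar>r * c\<bar>) \<longlongrightarrow> 0) (at_right 0)" by (simp add: tendsto_rabs_zero)
  then have "eventually (\<lambda>r. \<bar>r * c\<bar> < 1) (at_right 0)" by (rule order_tendstoD(2)) simp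
  moreover have "eventually (\<lambda>r. r > 0) (at_right (0::real))" by (rule eventually_at_right_less)
  ultimately show ?thesis
  proof eventually_elim
    case (elim r)
    consider "v = 1" "c \<le> 0" | "v = -1" "c \<ge> 0" using True assms(2) by (fastforce simp: abs_if split: if_splits)
    then show ?case
    proof cases
      case 1
      then have "r * c \<le> 0" using elim by (simp add: mult_nonneg_nonpos)
      then show ?thesis using 1 elim by auto
    next
      case 2
      then have "r * c \<ge> 0" using elim by simp
      then show ?thesis using 2 elim by auto
    qed
  qed
qed

section \<open>Feasible preimages of a vertex\<close>

locale vertex_step =
  fixes n d :: "nat \<Rightarrow> real" and zk v y :: real
    and S :: "(real^'m::{finite,linorder}) set" and x xk :: "real^'m::{finite,linorder}"
  assumes card: "CARD('m) \<ge> 2"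
    and d1: "d 1 = 1" and dm: "d (CARD('m) + 1) \<noteq> 0"
    and conv: "convex S" and bdd: "bounded S" and int: "interior S \<noteq> {}"
    and ext: "xk extreme_point_of step_set n d zk S"
    and x: "x \<in> S" and v: "\<bar>v\<bar> \<le> 1" and y: "\<bar>y - zk\<bar> \<le> 1"
    and y_eq: "y = C_vec n d \<bullet> x + n 1 * v"
    and xk: "xk = A_mat d *v x + v *\<^sub>R B_vec"
begin

text \<open>Moving an interior state both ways orthogonally to \<open>C_vec\<close> keeps the
  output, hence feasibility, and moves the image symmetrically about the vertex. The claim covers
  every feasible preimage because shifted ones occur below.\<close>

lemma fibre_not_interior:
  assumes "\<bar>v'\<bar> \<le> 1" "\<bar>C_vec n d \<bullet> x' + n 1 * v' - zk\<bar> \<le> 1"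
    and xk': "xk = A_mat d *v x' + v' *\<^sub>R B_vec"
  shows "x' \<notin> interior S"
proof
  assume "x' \<in> interior S"
  then obtain e where e: "e > 0" "cball x' e \<subseteq> S" using mem_interior_cball by blast
  have "2 \<le> DIM(real^'m::{finite,linorder})" using card by simp
  then obtain u :: "real^'m::{finite,linorder}" where u: "u \<noteq> 0" "orthogonal (C_vec n d) u"
    by (rule orthogonal_to_vector_exists)
  let ?h = "(e / norm u) *\<^sub>R u"
  have "x' + ?h \<in> S" "x' - ?h \<in> S" using e u by (auto simp: dist_norm subset_iff)
  then have "A_mat d *v (x' + ?h) + v' *\<^sub>R B_vec \<in> step_set n d zk S"
    "A_mat d *v (x' - ?h) + v' *\<^sub>R B_vec \<in> step_set n d zk S"
    using assms(1,2) u(2)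
    by (auto intro!: step_set_I simp: inner_right_distrib inner_diff_right orthogonal_def)
  then have "xk + A_mat d *v ?h \<in> step_set n d zk S" "xk - A_mat d *v ?h \<in> step_set n d zk S"
    unfolding xk' by (simp_all add: algebra_simps matrix_vector_right_distrib matrix_vector_mult_diff_distrib)
  then have "A_mat d *v ?h = 0" using extreme_point_symmetric[OF ext] by blast
  then have "?h = 0" by (rule A_mat_inj[OF d1 dm])
  with e u show False by simp
qed

lemma in_frontier: "x \<in> frontier S"
proof -
  have "x \<notin> interior S" using y unfolding y_eq by (intro fibre_not_interior[OF v _ xk])
  moreover have "x \<in> closure S" using x closure_subset by blast
  ultimately show ?thesis by (simp add: frontier_def)
qed

lemma R_nonempty: "R_set S x \<noteq> {}"
proof -
  have disj: "{x} \<inter> interior S = {}" using in_frontier by (auto simp: frontier_def)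
  obtain a where a: "a \<noteq> 0" "\<forall>t\<in>{x}. \<forall>y\<in>S. a \<bullet> y \<le> a \<bullet> t"
    by (rule convex_disjoint_interior_normal[OF conv int convex_singleton insert_not_empty disj])
  have "a \<in> C_O S x" unfolding C_O_iff[OF bdd x] using a by blast
  then show ?thesis unfolding R_set_empty_iff by blast
qed

text \<open>The output is then independent of the input, so slack in \<open>v\<close> would move the
  vertex both ways along \<open>B_vec\<close>.\<close>

lemma abs_v_eq_1:
  assumes "n 1 = 0"
  shows "\<bar>v\<bar> = 1"
proof (rule ccontr)
  assume "\<bar>v\<bar> \<noteq> 1"
  then have lt: "1 - \<bar>v\<bar> > 0" using v by simp
  let ?e = "1 - \<bar>v\<bar>"
  have "A_mat d *v x + (v + ?e) *\<^sub>R B_vec \<in> step_set n d zk S"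
    "A_mat d *v x + (v - ?e) *\<^sub>R B_vec \<in> step_set n d zk S"
    using lt y assms unfolding y_eq by (auto intro!: step_set_I x)
  then have "xk + ?e *\<^sub>R B_vec \<in> step_set n d zk S" "xk - ?e *\<^sub>R B_vec \<in> step_set n d zk S"
    unfolding xk by (simp_all add: scaleR_left_distrib scaleR_left_diff_distrib algebra_simps)
  then have "?e *\<^sub>R (B_vec :: real^'m::{finite,linorder}) = 0" using extreme_point_symmetric[OF ext] by blast
  then show False using lt B_vec_nonzero[where 'm = 'm] by simp
qed

lemma active_bound:
  assumes p: "x + s *\<^sub>R axis (Min UNIV) 1 \<in> interior S"
  shows "(\<bar>v\<bar> = 1 \<and> v * (d (CARD('m) + 1) * s) > 0)
    \<or> (\<bar>y - zk\<bar> = 1 \<and> (y - zk) * (n (CARD('m) + 1) * s) > 0)"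
proof (rule ccontr)
  let ?D = "d (CARD('m) + 1)" and ?N = "n (CARD('m) + 1)" and ?e = "axis (Min UNIV) 1 :: real^'m::{finite,linorder}"
  assume "\<not> ?thesis"
  then have "eventually (\<lambda>r. \<bar>v + r * (?D * s)\<bar> \<le> 1) (at_right 0)"
    "eventually (\<lambda>r. \<bar>(y - zk) + r * (?N * s)\<bar> \<le> 1) (at_right 0)"
    using v y by (auto intro: affine_stays_bounded)
  moreover have "eventually (\<lambda>r. r > 0) (at_right (0::real))" by (rule eventually_at_right_less)
  moreover have "eventually (\<lambda>r. r < 1) (at_right (0::real))"
    by (rule order_tendstoD(2)[OF tendsto_ident_at]) simp
  ultimately have "eventually (\<lambda>r. \<bar>v + r * (?D * s)\<bar> \<le> 1 \<and> \<bar>(y - zk) + r * (?N * s)\<bar> \<le> 1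
      \<and> r > 0 \<and> r < 1) (at_right 0)"
    by eventually_elim simp
  then obtain r where r: "\<bar>v + r * (?D * s)\<bar> \<le> 1" "\<bar>(y - zk) + r * (?N * s)\<bar> \<le> 1" "0 < r" "r < 1"
    using eventually_happens'[OF trivial_limit_at_right_real] by blast
  \<comment> \<open>Raising \<open>v\<close> by \<open>r * (?D * s)\<close> cancels the displacement
    along the first axis, so the image stays \<open>xk\<close> while the output changes by
    \<open>r * (?N * s)\<close>. As 0 < r < 1, the new state lies between \<open>x\<close> and an
    interior point, hence is interior.\<close>
  let ?x = "x + (r * s) *\<^sub>R ?e" and ?v = "v + r * (?D * s)"
  have "C_vec n d \<bullet> ?x + n 1 * ?v - zk = (y - zk) + r * (?N * s)"
    unfolding inner_right_distrib inner_scaleR_right C_vec_first_axis y_eq by (simp add: algebra_simps)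
  moreover have "xk = A_mat d *v ?x + ?v *\<^sub>R B_vec"
    unfolding xk matrix_vector_right_distrib matrix_vector_mult_scaleR A_mat_first_axis
    by (simp add: algebra_simps)
  ultimately have "?x \<notin> interior S" using r fibre_not_interior by simp
  moreover have "?x \<in> interior S"
    using mem_interior_convex_shrink[OF conv p x, of r] r by (simp add: algebra_simps)
  ultimately show False by blast
qed

lemma multipliers:
  assumes xs: "xs \<in> R_set S x"
  obtains vs ys where "(v, y, vs, ys) \<in> M_set CARD('m) n d (C_vec n d \<bullet> x) (first_comp xs) zk"
    "A_star d *v xs + ys *\<^sub>R B_star n d \<noteq> 0"
proof -
  let ?D = "d (CARD('m) + 1)" and ?N = "n (CARD('m) + 1)" and ?t = "first_comp xs"
  have xsC: "xs \<in> C_O S x" using xs R_set_subset by blast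
  then have xs0: "xs \<noteq> 0" by (simp add: C_O_def)
  note witness = that
  \<comment> \<open>The third condition keeps the new normal nonzero: otherwise the adjoint identity
    at state 0 and input 1 gives \<open>vs + n 1 * ys = 0\<close>, so \<open>ys = 0\<close>, and
    then at state \<open>xs\<close> and input 0 it gives \<open>xs = 0\<close>.\<close>
  have found: thesis
    if "aligned zk y v ys vs" and t: "?D * vs + ?N * ys = - ?t"
      and "ys = 0 \<or> vs + n 1 * ys \<noteq> 0" for vs ys
  proof (rule witness)
    show "(v, y, vs, ys) \<in> M_set CARD('m) n d (C_vec n d \<bullet> x) ?t zk"
      using that v y y_eq by (simp add: M_set_def)
    show "A_star d *v xs + ys *\<^sub>R B_star n d \<noteq> 0"
    proof
      assume "A_star d *v xs + ys *\<^sub>R B_star n d = 0"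
      then have eq: "xs \<bullet> x' + ys * (C_vec n d \<bullet> x' + n 1 * v') + vs * v' = 0" for x' v'
        using step_adjoint[where d = d and n = n, OF d1 dm t, of x' v'] by simp
      from eq[of 0 1] that(3) have "ys = 0" by (simp add: algebra_simps)
      with eq[of xs 0] xs0 show False by simp
    qed
  qed
  show thesis
  proof (cases "?t = 0")
    case True
    show thesis by (rule found[of 0 0]) (auto simp: aligned_def True)
  next
    case False
    obtain s where s: "x + s *\<^sub>R axis (Min UNIV) 1 \<in> interior S"
      using first_axis_meets_interior[OF conv bdd int x] R_set_first_comp_nonzero[OF xs False] by blast
    \<comment> \<open>The normal is strictly smaller at the interior point than at
      \<open>x\<close>.\<close>
    have st: "s * ?t < 0"
      using outer_normal_interior_less[OF bdd x xsC s]
      by (simp add: inner_right_distrib inner_axis first_comp_def)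
    have act: "active b (- ?t / D)" if "\<bar>b\<bar> = 1" "b * (D * s) > 0" for b D
      using active_sign[OF that(2) st] that(1) by (intro activeI) blast
    have act0: "active b 0" for b by (simp add: activeI)
    show thesis
    proof (cases "\<bar>v\<bar> = 1 \<and> v * (?D * s) > 0")
      case True
      show thesis
      proof (rule found)
        show "aligned zk y v 0 (- ?t / ?D)"
          unfolding aligned_iff_active using act[of v ?D] act0 True by blast
      qed (use dm in simp_all)
    next
      case nv: False
      then have y1: "\<bar>y - zk\<bar> = 1" "(y - zk) * (?N * s) > 0" using active_bound[OF s] by blast+
      then have N: "?N \<noteq> 0" by auto
      note y_act = act[OF y1]
      \<comment> \<open>With all weight on \<open>ys\<close>, the nonvanishing condition becomes
        \<open>n 1 * ys \<noteq> 0\<close>.\<close>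
      show thesis
      proof (cases "n 1 = 0")
        case n1: False
        show thesis
        proof (rule found)
          show "aligned zk y v (- ?t / ?N) 0"
            unfolding aligned_iff_active using y_act act0 by blast
          show "?D * 0 + ?N * (- ?t / ?N) = - ?t" using N by simp
          show "- ?t / ?N = 0 \<or> 0 + n 1 * (- ?t / ?N) \<noteq> 0" using n1 N False by simp
        qed
      next
        \<comment> \<open>Taking \<open>v\<^sup>* = 0\<close> could give the zero vector here, so \<open>y\<^sup>*\<close> is doubled and \<open>v\<^sup>*\<close> compensates.\<close>
        case n1: True
        have v1: "\<bar>v\<bar> = 1" by (rule abs_v_eq_1[OF n1])
        \<comment> \<open>Here \<open>v\<close> is at the bound on the side away from the interior,
          so its multiplier has the opposite sign, \<open>?t / ?D\<close>; the total is
          \<open>?t - 2 * ?t = - ?t\<close>.\<close>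
        have "s \<noteq> 0" using st by auto
        then have "v * (?D * s) \<noteq> 0" using v1 dm by auto
        with nv v1 have "v * (- ?D * s) > 0" by (simp add: not_less order_less_le)
        then have "active v (- ?t / - ?D)" using v1 by (intro act)
        moreover have "active (y - zk) (2 * (- ?t / ?N))"
          by (rule active_scale[OF y_act]) simp
        ultimately have al: "aligned zk y v (2 * (- ?t / ?N)) (- ?t / - ?D)"
          unfolding aligned_iff_active by blast
        show thesis
        proof (rule found[OF al])
          show "?D * (- ?t / - ?D) + ?N * (2 * (- ?t / ?N)) = - ?t" using N dm by simp
          show "2 * (- ?t / ?N) = 0 \<or> - ?t / - ?D + n 1 * (2 * (- ?t / ?N)) \<noteq> 0"
            using n1 dm False by simp
        qed
      qed
    qed
  qed
qed

lemma T_set_normal: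
  assumes "xs \<in> R_set S x"
  shows "\<exists>xks \<in> C_O (step_set n d zk S) xk. (xk, xks) \<in> T_set n d x xs zk"
proof -
  obtain vs ys where M: "(v, y, vs, ys) \<in> M_set CARD('m) n d (C_vec n d \<bullet> x) (first_comp xs) zk"
    and nz: "A_star d *v xs + ys *\<^sub>R B_star n d \<noteq> 0" by (rule multipliers[OF assms])
  have xsC: "xs \<in> C_O S x" using assms R_set_subset by blast
  have "A_star d *v xs + ys *\<^sub>R B_star n d \<in> C_O (step_set n d zk S) xk"
    unfolding xk by (rule outer_normal_step[OF d1 dm bdd x xsC M nz])
  moreover have "(xk, A_star d *v xs + ys *\<^sub>R B_star n d) \<in> T_set n d x xs zk"
    unfolding T_set_def xk using M nz by blast
  ultimately show ?thesis by blast
qed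

end

theorem theorem3p7:
  fixes n d z :: "nat \<Rightarrow> real"
    and x0 xk :: "real^'m::{finite,linorder}"
    and k :: nat
  assumes "CARD('m) \<ge> 2"
    and "d 1 = 1"
    and "d (CARD('m) + 1) \<noteq> 0"
    and "coprime (coeff_poly CARD('m) n) (coeff_poly CARD('m) d)"
    and "k \<ge> 1"
    and "interior (unc_set n d z x0 (k - 1)) \<noteq> {}"
    and "xk extreme_point_of unc_set n d z x0 k"
  shows "\<exists>x \<in> frontier (unc_set n d z x0 (k - 1)).
           xk \<in> X_set n d (unc_set n d z x0 (k - 1)) x (z k) \<and>
           (\<forall>xs \<in> R_set (unc_set n d z x0 (k - 1)) x.
              \<exists>xks \<in> C_O (unc_set n d z x0 k) xk. (xk, xks) \<in> T_set n d x xs (z k))"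
proof -
  let ?S = "unc_set n d z x0 (k - 1)"
  have Sk: "unc_set n d z x0 k = step_set n d (z k) ?S"
    using unc_set_Suc[of n d z x0 "k - 1"] assms(5) by simp
  have ext: "xk extreme_point_of step_set n d (z k) ?S" using assms(7) unfolding Sk .
  then have "xk \<in> step_set n d (z k) ?S" by (simp add: extreme_point_of_def)
  \<comment> \<open>Any feasible preimage of the vertex serves as the required boundary
    point.\<close>
  then obtain x v where x: "xk = A_mat d *v x + v *\<^sub>R B_vec" "x \<in> ?S" "\<bar>v\<bar> \<le> 1"
    "\<bar>C_vec n d \<bullet> x + n 1 * v - z k\<bar> \<le> 1"
    unfolding step_set_def by blast
  interpret vertex_step n d "z k" v "C_vec n d \<bullet> x + n 1 * v" ?S x xk
    using assms(1-3,6) ext x by unfold_locales (simp_all add: convex_unc_set bounded_unc_set)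
  have "xk \<in> X_set n d ?S x (z k)"
    unfolding X_set_def X_of_def using R_nonempty T_set_normal by blast
  then show ?thesis unfolding Sk using in_frontier T_set_normal by blast
qed

end
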